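(* Let $\{A(t)\}_{t\ge0}$ be a discrete time chain of $N\times N$ row-stochastic matrices. Then $\{A(t)\}$ is full-rank, i.e. $\mathbf{rank}(A)=N$, if and only if $\{A(t)\}$ is an $l_1$-approximation of a permutation chain, i.e. of a chain $\{P(t)\}_{t\ge0}$ in which every $P(t)$ is a permutation matrix.
   Context: Time indices are non-negative integers. The state transition matrix of the chain is $\Phi(t,\tau)=A(t-1)\cdots A(\tau)$ for $t>\tau\ge0$, and $\Phi(t,t)=I$. Rank: for $\tau\ge0$, $\mathbf{null}_\tau(A)=\{v\in\mathbb R^N:\lim_{t\to\infty}\Phi(t,\tau)v=\mathbf 0_N\}$. Its dimension is non-increasing in $\tau$, hence eventually constant. $\mathbf{nullity}(A)=\lim_{\tau\to\infty}\dim(\mathbf{null}_\tau(A))$ and $\mathbf{rank}(A)=N-\mathbf{nullity}(A)$. $\{A(t)\}$ is an $l_1$-approximation of $\{B(t)\}$ if $\sum_{t=0}^\infty\|A(t)-B(t)\|<\infty$, where $\|\cdot\|$ is the maximum of the absolute values of the matrix entries. *)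

theory Defs
  imports "HOL-Analysis.Analysis"
begin

definition row_stochastic :: "real ^ 'n ^ 'n \<Rightarrow> bool" where
  "row_stochastic M \<longleftrightarrow> (\<forall>i j. 0 \<le> M $ i $ j) \<and> (\<forall>i. (\<Sum>j\<in>UNIV. M $ i $ j) = 1)"

definition permutation_matrix :: "real ^ 'n ^ 'n \<Rightarrow> bool" where
  "permutation_matrix M \<longleftrightarrow>
     (\<exists>p. p permutes UNIV \<and> M = (\<chi> i j. if j = p i then 1 else 0))"

text \<open>The value for \<open>t < \<tau>\<close> is a dummy.\<close>

fun transition_matrix :: "(nat \<Rightarrow> real ^ 'n ^ 'n) \<Rightarrow> nat \<Rightarrow> nat \<Rightarrow> real ^ 'n ^ 'n" where
  "transition_matrix A 0 \<tau> = mat 1"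
| "transition_matrix A (Suc t) \<tau> =
     (if \<tau> \<le> t then A t ** transition_matrix A t \<tau> else mat 1)"

definition chain_null :: "(nat \<Rightarrow> real ^ 'n ^ 'n) \<Rightarrow> nat \<Rightarrow> (real ^ 'n) set" where
  "chain_null A \<tau> = {v. (\<lambda>t. transition_matrix A t \<tau> *v v) \<longlonglongrightarrow> 0}"

definition chain_nullity :: "(nat \<Rightarrow> real ^ 'n ^ 'n) \<Rightarrow> nat" where
  "chain_nullity A = lim (\<lambda>\<tau>. dim (chain_null A \<tau>))"

definition chain_rank :: "(nat \<Rightarrow> real ^ 'n ^ 'n) \<Rightarrow> nat" where
  "chain_rank A = CARD('n) - chain_nullity A"

definition max_entry_norm :: "real ^ 'n ^ 'n \<Rightarrow> real" where
  "max_entry_norm M = Max (range (\<lambda>(i, j). \<bar>M $ i $ j\<bar>))"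

definition l1_approximation ::
    "(nat \<Rightarrow> real ^ 'n ^ 'n) \<Rightarrow> (nat \<Rightarrow> real ^ 'n ^ 'n) \<Rightarrow> bool" where
  "l1_approximation A B \<longleftrightarrow> summable (\<lambda>t. max_entry_norm (A t - B t))"

text \<open>
  The sequence of dimensions is non-increasing, so the limit defining \<open>chain_nullity\<close> exists and
  is at most the dimension of the space; the subtraction in \<open>chain_rank\<close> does not truncate.
\<close>

lemma transition_matrix_self [simp]: "transition_matrix A \<tau> \<tau> = mat 1"
  by (cases \<tau>) auto

lemma transition_matrix_shift:
  assumes "\<tau> < t"
  shows "transition_matrix A t \<tau> = transition_matrix A t (Suc \<tau>) ** A \<tau>"
proof -
  have "transition_matrix A (Suc (\<tau> + k)) \<tau> = transition_matrix A (Suc (\<tau> + k)) (Suc \<tau>) ** A \<tau>" for k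
  proof (induction k)
    case 0
    show ?case by simp
  next
    case (Suc k)
    have "transition_matrix A (Suc (\<tau> + Suc k)) \<tau> = A (\<tau> + Suc k) ** transition_matrix A (Suc (\<tau> + k)) \<tau>"
      by simp
    also have "\<dots> = A (\<tau> + Suc k) ** (transition_matrix A (Suc (\<tau> + k)) (Suc \<tau>) ** A \<tau>)"
      by (simp only: Suc)
    also have "\<dots> = transition_matrix A (Suc (\<tau> + Suc k)) (Suc \<tau>) ** A \<tau>"
      by (simp add: matrix_mul_assoc)
    finally show ?case .
  qed
  from this[of "t - Suc \<tau>"] assms show ?thesis by simp
qed

lemma subspace_chain_null: "subspace (chain_null A \<tau>)"
proof (rule subspaceI)
  show "0 \<in> chain_null A \<tau>"
    by (simp add: chain_null_def)
next
  fix x y assume "x \<in> chain_null A \<tau>" "y \<in> chain_null A \<tau>"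
  then show "x + y \<in> chain_null A \<tau>"
    using tendsto_add[of _ "0 :: real ^ _" _ _ "0 :: real ^ _"]
    by (fastforce simp: chain_null_def matrix_vector_right_distrib)
next
  fix c x assume "x \<in> chain_null A \<tau>"
  then show "c *\<^sub>R x \<in> chain_null A \<tau>"
    using tendsto_scaleR[OF tendsto_const[of c], of _ "0 :: real ^ _"]
    by (fastforce simp: chain_null_def matrix_vector_mult_scaleR)
qed

lemma mem_chain_null_Suc: "v \<in> chain_null A \<tau> \<longleftrightarrow> A \<tau> *v v \<in> chain_null A (Suc \<tau>)"
proof -
  have "\<forall>\<^sub>F t in sequentially. transition_matrix A t \<tau> *v v = transition_matrix A t (Suc \<tau>) *v (A \<tau> *v v)"
    using eventually_gt_at_top[of \<tau>]
    by eventually_elim (simp add: transition_matrix_shift matrix_vector_mul_assoc)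
  then show ?thesis
    unfolding chain_null_def by (simp add: tendsto_cong)
qed

lemma dim_le_dim_preimage:
  fixes M :: "real ^ 'n ^ 'm"
  assumes W: "subspace W"
  shows "dim W + CARD('n) \<le> dim {v. M *v v \<in> W} + CARD('m)"
proof -
  define U where "U = (\<lambda>x. transpose M *v x) ` (W\<^sup>\<bottom>)"
  have lin: "linear (\<lambda>x. transpose M *v x)"
    by (rule matrix_vector_mul_linear)
  have U: "subspace U"
    unfolding U_def by (rule linear_subspace_image[OF lin subspace_orthogonal_comp])
  have "M *v v \<in> W \<longleftrightarrow> (\<forall>x\<in>W\<^sup>\<bottom>. x \<bullet> (M *v v) = 0)" for v
  proof -
    have "M *v v \<in> W \<longleftrightarrow> M *v v \<in> W\<^sup>\<bottom>\<^sup>\<bottom>"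
      by (simp add: orthogonal_comp_self[OF W])
    then show ?thesis
      unfolding orthogonal_comp_def[of "W\<^sup>\<bottom>"] by (auto simp: orthogonal_def)
  qed
  then have eq: "{v. M *v v \<in> W} = {v \<in> UNIV. \<forall>u\<in>U. orthogonal u v}"
    by (simp add: U_def orthogonal_def dot_lmul_matrix)
  have "dim {v. M *v v \<in> W} + dim U = CARD('n)"
    using dim_subspace_orthogonal_to_vectors[OF U subspace_UNIV] by (simp add: eq)
  moreover have "dim U \<le> dim (W\<^sup>\<bottom>)"
    unfolding U_def by (rule dim_image_le[OF lin])
  moreover have "dim (W\<^sup>\<bottom>) + dim W = CARD('m)"
    using dim_subspace_orthogonal_to_vectors[OF W subspace_UNIV]
    by (simp add: orthogonal_comp_def)
  ultimately show ?thesis by linarith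
qed

lemma dim_chain_null_Suc_le: "dim (chain_null A (Suc \<tau>)) \<le> dim (chain_null A \<tau>)"
proof -
  have "chain_null A \<tau> = {v. A \<tau> *v v \<in> chain_null A (Suc \<tau>)}"
    using mem_chain_null_Suc by blast
  then show ?thesis
    using dim_le_dim_preimage[OF subspace_chain_null[of A "Suc \<tau>"], of "A \<tau>"] by simp
qed

lemma chain_nullity_tendsto: "(\<lambda>\<tau>. dim (chain_null A \<tau>)) \<longlonglongrightarrow> chain_nullity A"
proof -
  define d where "d \<tau> = dim (chain_null A \<tau>)" for \<tau>
  have dec: "decseq d"
    unfolding d_def by (rule decseq_SucI) (rule dim_chain_null_Suc_le)
  define m where "m = (LEAST k. k \<in> range d)"
  have "m \<in> range d"
    unfolding m_def by (rule LeastI[of _ "d 0"]) simp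
  then obtain \<sigma> where \<sigma>: "d \<sigma> = m" by auto
  have "d \<tau> = m" if "\<sigma> \<le> \<tau>" for \<tau>
    using decseqD[OF dec that] \<sigma> Least_le[of "\<lambda>k. k \<in> range d" "d \<tau>"] by (simp add: m_def)
  then have "d \<longlonglongrightarrow> m"
    by (intro tendsto_eventually) (auto simp: eventually_sequentially)
  then show ?thesis
    unfolding chain_nullity_def d_def[symmetric] by (simp add: limI)
qed

lemma chain_nullity_le: "chain_nullity (A :: nat \<Rightarrow> real ^ 'n ^ 'n) \<le> CARD('n)"
proof (rule LIMSEQ_le_const2[OF chain_nullity_tendsto])
  show "\<exists>N. \<forall>n\<ge>N. dim (chain_null A n) \<le> CARD('n)"
    using dim_subset_UNIV_cart by blast
qed

end

theory Submission
  imports Defs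
begin

text \<open>
  Stochastic matrices contract the supremum norm and permutation matrices preserve it. Hence if
  \<open>A\<close> is summably close to a permutation chain, \<open>A\<close> shrinks vectors only by a convergent product of
  factors, and no nonzero vector is sent to \<open>0\<close> from a late starting time.

  Conversely, let the null spaces be trivial from time \<open>T\<close> on. A limit point of \<open>\<Phi>(t, T)\<close> is
  injective, because the supremum norm decreases along trajectories; so \<open>\<bar>det \<Phi>(t, T)\<bar>\<close> decreases
  to a positive limit and \<open>\<Sum>(1 - \<bar>det A(t)\<bar>)\<close> converges. Reading the rows of \<open>A(t)\<close> as independent
  random columns, \<open>\<bar>det A(t)\<bar>\<close> is at most the probability that the chosen columns are distinct,
  so \<open>1 - \<bar>det A(t)\<bar>\<close> bounds the inner product of any two rows. Small inner products force
  \<open>A(t)\<close> to be close, linearly in that bound, to a permutation matrix.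
\<close>

section \<open>Stochastic and permutation matrices\<close>

lemma row_stochastic_nonneg: "row_stochastic M \<Longrightarrow> 0 \<le> M $ i $ j"
  by (simp add: row_stochastic_def)

lemma row_stochastic_sum: "row_stochastic M \<Longrightarrow> (\<Sum>j\<in>UNIV. M $ i $ j) = 1"
  by (simp add: row_stochastic_def)

lemma row_stochastic_le_1:
  assumes "row_stochastic M"
  shows "M $ i $ j \<le> 1"
proof -
  have "M $ i $ j \<le> (\<Sum>j\<in>UNIV. M $ i $ j)"
    by (rule member_le_sum) (simp_all add: row_stochastic_nonneg[OF assms])
  then show ?thesis
    by (simp add: row_stochastic_sum[OF assms])
qed

lemma row_stochastic_mult:
  assumes A: "row_stochastic A" and B: "row_stochastic B"
  shows "row_stochastic (A ** B)"
  unfolding row_stochastic_def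
proof (intro conjI allI)
  fix i j
  show "0 \<le> (A ** B) $ i $ j"
    using A B by (auto simp: matrix_matrix_mult_def row_stochastic_nonneg intro!: sum_nonneg)
  have "(\<Sum>j\<in>UNIV. (A ** B) $ i $ j) = (\<Sum>k\<in>UNIV. \<Sum>j\<in>UNIV. A $ i $ k * B $ k $ j)"
    unfolding matrix_matrix_mult_def by (simp, subst sum.swap, simp)
  also have "\<dots> = 1"
    by (simp add: sum_distrib_left[symmetric] row_stochastic_sum[OF A] row_stochastic_sum[OF B])
  finally show "(\<Sum>j\<in>UNIV. (A ** B) $ i $ j) = 1" .
qed

lemma row_stochastic_mat_1: "row_stochastic (mat 1)"
  by (simp add: row_stochastic_def mat_def)

lemma permutation_matrix_imp_row_stochastic: "permutation_matrix M \<Longrightarrow> row_stochastic M"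
  by (auto simp: permutation_matrix_def row_stochastic_def)

lemma permutation_matrix_mat_1: "permutation_matrix (mat 1)"
  unfolding permutation_matrix_def
  by (intro exI[of _ id]) (auto simp: mat_def vec_eq_iff permutes_id)

lemma row_stochastic_transition_matrix:
  assumes "\<And>t. row_stochastic (A t)"
  shows "row_stochastic (transition_matrix A t \<tau>)"
  by (induction t) (simp_all add: row_stochastic_mat_1 row_stochastic_mult assms)

text \<open>This bound supplies the compactness from which a limit point of the transition matrices
  is drawn.\<close>

lemma norm_row_stochastic_le:
  fixes M :: "real ^ 'n ^ 'n"
  assumes "row_stochastic M"
  shows "norm M \<le> CARD('n)"
proof -
  have "norm M \<le> (\<Sum>i\<in>UNIV. norm (M $ i))"
    unfolding norm_vec_def[of M] by (rule L2_set_le_sum) simp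
  also have "\<dots> \<le> (\<Sum>i\<in>(UNIV :: 'n set). 1)"
  proof (rule sum_mono)
    fix i
    have "norm (M $ i) \<le> (\<Sum>j\<in>UNIV. \<bar>M $ i $ j\<bar>)"
      by (rule norm_le_l1_cart)
    then show "norm (M $ i) \<le> 1"
      by (simp add: row_stochastic_nonneg[OF assms] row_stochastic_sum[OF assms])
  qed
  finally show ?thesis by simp
qed

section \<open>The supremum norm along trajectories\<close>

lemma infnorm_le_cart:
  fixes x :: "real ^ 'n"
  assumes "\<And>i. \<bar>x $ i\<bar> \<le> b"
  shows "infnorm x \<le> b"
  unfolding infnorm_cart by (rule cSup_least) (auto simp: assms)

lemma infnorm_matrix_vector_le:
  fixes M :: "real ^ 'n ^ 'm" and x :: "real ^ 'n"
  assumes "\<And>i. (\<Sum>j\<in>UNIV. \<bar>M $ i $ j\<bar>) \<le> c"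
  shows "infnorm (M *v x) \<le> c * infnorm x"
proof (rule infnorm_le_cart)
  fix i
  have "\<bar>(M *v x) $ i\<bar> \<le> (\<Sum>j\<in>UNIV. \<bar>M $ i $ j * x $ j\<bar>)"
    unfolding matrix_vector_mult_def by simp
  also have "\<dots> \<le> (\<Sum>j\<in>UNIV. \<bar>M $ i $ j\<bar> * infnorm x)"
    by (intro sum_mono) (simp add: abs_mult mult_left_mono component_le_infnorm_cart)
  also have "\<dots> \<le> c * infnorm x"
    by (simp add: sum_distrib_right[symmetric] mult_right_mono assms infnorm_pos_le)
  finally show "\<bar>(M *v x) $ i\<bar> \<le> c * infnorm x" .
qed

lemma infnorm_row_stochastic_le:
  assumes "row_stochastic M"
  shows "infnorm (M *v x) \<le> infnorm x"
  using infnorm_matrix_vector_le[of M 1 x]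
  by (simp add: row_stochastic_nonneg[OF assms] row_stochastic_sum[OF assms])

lemma infnorm_permutation_matrix:
  fixes x :: "real ^ 'n"
  assumes "permutation_matrix M"
  shows "infnorm (M *v x) = infnorm x"
proof (rule antisym)
  show "infnorm (M *v x) \<le> infnorm x"
    by (intro infnorm_row_stochastic_le permutation_matrix_imp_row_stochastic assms)
  obtain p where p: "p permutes UNIV" and M: "M = (\<chi> i j. if j = p i then 1 else 0)"
    using assms by (auto simp: permutation_matrix_def)
  have "(M *v x) $ i = x $ p i" for i
    by (simp add: M matrix_vector_mult_def if_distrib[of "\<lambda>c. c * _"] cong: if_cong)
  \<comment> \<open>Coordinate \<open>i\<close> of \<open>x\<close> reappears in
    \<open>M *v x\<close> at position \<open>inv p i\<close>.\<close>
  then have "\<bar>x $ i\<bar> \<le> infnorm (M *v x)" for i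
    using component_le_infnorm_cart[of "M *v x" "inv p i"] permutes_inverses(1)[OF p] by simp
  then show "infnorm x \<le> infnorm (M *v x)"
    by (rule infnorm_le_cart)
qed

lemma abs_le_max_entry_norm:
  fixes M :: "real ^ 'n ^ 'n"
  shows "\<bar>M $ i $ j\<bar> \<le> max_entry_norm M"
  unfolding max_entry_norm_def by (rule Max_ge) (auto intro: rev_image_eqI[of "(i, j)"])

lemma max_entry_norm_le:
  fixes M :: "real ^ 'n ^ 'n"
  assumes "\<And>i j. \<bar>M $ i $ j\<bar> \<le> b"
  shows "max_entry_norm M \<le> b"
  unfolding max_entry_norm_def by (subst Max_le_iff) (auto simp: assms)

lemma max_entry_norm_nonneg: "0 \<le> max_entry_norm M"
  by (rule order_trans[OF abs_ge_zero abs_le_max_entry_norm])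

lemma infnorm_transition_antimono:
  assumes A: "\<And>t. row_stochastic (A t)" and "\<tau> \<le> s" "s \<le> t"
  shows "infnorm (transition_matrix A t \<tau> *v v) \<le> infnorm (transition_matrix A s \<tau> *v v)"
  using assms(3)
proof (induction t rule: dec_induct)
  case (step n)
  have "infnorm (transition_matrix A (Suc n) \<tau> *v v) \<le> infnorm (transition_matrix A n \<tau> *v v)"
    using infnorm_row_stochastic_le[OF A] step \<open>\<tau> \<le> s\<close>
    by (simp add: matrix_vector_mul_assoc[symmetric])
  then show ?case using step by simp
qed simp

section \<open>Chains close to a permutation chain\<close>

text \<open>Write \<open>P *v x\<close> as \<open>A *v x\<close> plus \<open>(P - A) *v x\<close>:
  \<open>P\<close> preserves the supremum norm, and the absolute row sums of \<open>P - A\<close>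
  are at most the dimension times the largest entry.\<close>

lemma infnorm_near_permutation_ge:
  fixes A P :: "real ^ 'n ^ 'n"
  assumes "permutation_matrix P"
  shows "infnorm (A *v x) \<ge> infnorm x - CARD('n) * max_entry_norm (A - P) * infnorm x"
proof -
  have "infnorm ((P - A) *v x) \<le> (CARD('n) * max_entry_norm (A - P)) * infnorm x"
  proof (rule infnorm_matrix_vector_le)
    fix i
    have "(\<Sum>j\<in>UNIV. \<bar>(P - A) $ i $ j\<bar>) \<le> (\<Sum>j\<in>(UNIV :: 'n set). max_entry_norm (A - P))"
      using abs_le_max_entry_norm[of "A - P" i] by (intro sum_mono) (simp add: abs_minus_commute)
    then show "(\<Sum>j\<in>UNIV. \<bar>(P - A) $ i $ j\<bar>) \<le> CARD('n) * max_entry_norm (A - P)" by simp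
  qed
  moreover have "infnorm (P *v x) \<le> infnorm (A *v x) + infnorm ((P - A) *v x)"
    using infnorm_triangle[of "A *v x" "(P - A) *v x"]
    by (simp add: matrix_vector_mult_diff_rdistrib)
  ultimately show ?thesis
    using infnorm_permutation_matrix[OF assms, of x] by simp
qed

lemma chain_null_eventually_trivial:
  fixes A P :: "nat \<Rightarrow> real ^ 'n ^ 'n"
  assumes A: "\<And>t. row_stochastic (A t)" and P: "\<And>t. permutation_matrix (P t)"
    and l1: "l1_approximation A P"
  shows "\<forall>\<^sub>F \<tau> in sequentially. chain_null A \<tau> = {0}"
proof -
  define e where "e t = CARD('n) * max_entry_norm (A t - P t)" for t
  have e0: "0 \<le> e t" for t
    by (simp add: e_def max_entry_norm_nonneg)
  have sm: "summable e"
    using l1 unfolding e_def l1_approximation_def by (rule summable_mult)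
  \<comment> \<open>With tails of \<open>e\<close> below 1/2, a vector started at or after
    \<open>T\<close> keeps at least half of its supremum norm forever.\<close>
  obtain T where T: "\<And>m n. m \<ge> T \<Longrightarrow> norm (sum e {m..<n}) < 1 / 2"
    using sm[unfolded summable_Cauchy, rule_format, of "1 / 2"] by auto
  have "chain_null A \<tau> = {0}" if "T \<le> \<tau>" for \<tau>
  proof -
    have "v = 0" if v: "v \<in> chain_null A \<tau>" for v
    proof -
      define w where "w t = infnorm (transition_matrix A t \<tau> *v v)" for t
      have w_le: "w t \<le> infnorm v" if "\<tau> \<le> t" for t
        using infnorm_transition_antimono[OF A order_refl that, where v = v] by (simp add: w_def)
      have w_ge: "w t \<ge> infnorm v - sum e {\<tau>..<t} * infnorm v" if "\<tau> \<le> t" for t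
        using that
      proof (induction t rule: dec_induct)
        case base
        show ?case by (simp add: w_def)
      next
        case (step t)
        have "w (Suc t) \<ge> w t - e t * w t"
          using infnorm_near_permutation_ge[OF P, where A = "A t" and x = "transition_matrix A t \<tau> *v v"] step(1)
          by (simp add: w_def e_def matrix_vector_mul_assoc)
        \<comment> \<open>Since norms never grow, each loss is measured against the initial norm, so
          the losses simply add up.\<close>
        moreover have "e t * w t \<le> e t * infnorm v"
          using w_le[OF step(1)] e0 by (rule mult_left_mono)
        ultimately show ?case
          using step by (simp add: algebra_simps)
      qed
      have "infnorm v / 2 \<le> w t" if "\<tau> \<le> t" for t
      proof -
        have "sum e {\<tau>..<t} * infnorm v \<le> 1 / 2 * infnorm v"
          using T[OF \<open>T \<le> \<tau>\<close>, of t] by (intro mult_right_mono infnorm_pos_le) auto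
        then show ?thesis using w_ge[OF that] by simp
      qed
      moreover have "w \<longlonglongrightarrow> infnorm (0 :: real ^ 'n)"
        using v unfolding w_def chain_null_def by (intro tendsto_infnorm) simp
      ultimately have "infnorm v / 2 \<le> infnorm (0 :: real ^ 'n)"
        by (intro LIMSEQ_le_const[of w]) auto
      then show ?thesis
        using infnorm_pos_lt[of v] by (force simp: infnorm_0)
    qed
    then show ?thesis
      using subspace_0[OF subspace_chain_null[of A \<tau>]] by auto
  qed
  then show ?thesis
    unfolding eventually_sequentially by blast
qed

section \<open>Stochastic matrices of large determinant\<close>

lemma sum_prod_functions:
  fixes g :: "'a :: finite \<Rightarrow> 'b :: finite \<Rightarrow> real"
  shows "(\<Sum>f\<in>UNIV. \<Prod>l\<in>UNIV. g l (f l)) = (\<Prod>l\<in>UNIV. \<Sum>m\<in>UNIV. g l m)"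
proof -
  \<comment> \<open>Extensionality outside \<open>UNIV\<close> is vacuous, so the dependent product
    is the whole function type.\<close>
  have eq: "PiE (UNIV :: 'a set) (\<lambda>_. UNIV :: 'b set) = UNIV"
    by (auto simp: PiE_def extensional_def)
  show ?thesis
    using prod_sum_PiE[of "UNIV :: 'a set" "\<lambda>_. UNIV :: 'b set" g] unfolding eq by simp
qed

text \<open>Drop the signs in the Leibniz expansion. Describing the index set by \<open>inj\<close>
  makes its disjointness from the functions with a collision immediate.\<close>

lemma abs_det_le_injective_sum:
  fixes M :: "real ^ 'n ^ 'n"
  assumes M: "row_stochastic M"
  shows "\<bar>det M\<bar> \<le> (\<Sum>f | inj f. \<Prod>l\<in>UNIV. M $ l $ f l)"
proof -
  have "\<bar>det M\<bar> \<le> (\<Sum>p | p permutes (UNIV :: 'n set). \<bar>of_int (sign p) * (\<Prod>l\<in>UNIV. M $ l $ p l)\<bar>)"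
    unfolding det_def by (rule sum_abs)
  also have "\<dots> = (\<Sum>p | p permutes (UNIV :: 'n set). \<Prod>l\<in>UNIV. M $ l $ p l)"
    by (intro sum.cong)
       (auto simp: abs_mult abs_prod sign_def row_stochastic_nonneg[OF M])
  also have "\<dots> \<le> (\<Sum>f | inj f. \<Prod>l\<in>UNIV. M $ l $ f l)"
    by (intro sum_mono2) (auto simp: permutes_inj row_stochastic_nonneg[OF M] intro!: prod_nonneg)
  finally show ?thesis .
qed

text \<open>Total probability: row \<open>l\<close> independently picks column \<open>f l\<close>
  with probability \<open>M $ l $ f l\<close>.\<close>

lemma sum_functions_eq_1:
  fixes M :: "real ^ 'n ^ 'n"
  assumes "row_stochastic M"
  shows "(\<Sum>f\<in>UNIV. \<Prod>l\<in>UNIV. M $ l $ f l) = 1"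
  using sum_prod_functions[of "\<lambda>l m. M $ l $ m"] by (simp add: row_stochastic_sum[OF assms])

text \<open>Both sides are the probability that rows \<open>i\<close> and \<open>k\<close> pick the
  same column; the right side splits it by the common column \<open>j\<close>.\<close>

lemma sum_functions_collision:
  fixes M :: "real ^ 'n ^ 'n"
  assumes M: "row_stochastic M" and "i \<noteq> k"
  shows "(\<Sum>f | f i = f k. \<Prod>l\<in>UNIV. M $ l $ f l) = (\<Sum>j\<in>UNIV. M $ i $ j * M $ k $ j)"
proof -
  \<comment> \<open>\<open>g j\<close> erases rows \<open>i\<close> and \<open>k\<close> outside
    column \<open>j\<close>. This encodes the event that both pick \<open>j\<close> while keeping
    the weight a product over rows, so the sum over \<open>f\<close> still factorises.\<close>
  define g where "g j l m = (if l \<in> {i, k} \<and> m \<noteq> j then 0 else M $ l $ m)" for j l m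
  have *: "(\<Sum>j\<in>UNIV. \<Prod>l\<in>UNIV. g j l (f l)) = (if f i = f k then \<Prod>l\<in>UNIV. M $ l $ f l else 0)" for f
  proof -
    have "(\<Prod>l\<in>UNIV. g j l (f l)) = (if f i = j \<and> f k = j then \<Prod>l\<in>UNIV. M $ l $ f l else 0)" for j
    proof (cases "f i = j \<and> f k = j")
      case True
      then show ?thesis by (auto simp: g_def intro!: prod.cong)
    next
      case False
      then have "g j i (f i) = 0 \<or> g j k (f k) = 0" by (auto simp: g_def)
      then have "(\<Prod>l\<in>UNIV. g j l (f l)) = 0" by (intro prod_zero) auto
      then show ?thesis using False by auto
    qed
    then show ?thesis by (cases "f i = f k") (auto intro!: sum.neutral)
  qed
  have **: "(\<Prod>l\<in>UNIV. \<Sum>m\<in>UNIV. g j l m) = M $ i $ j * M $ k $ j" for j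
  proof -
    have row: "(\<Sum>m\<in>UNIV. g j l m) = (if l \<in> {i, k} then M $ l $ j else 1)" for l
    proof (cases "l \<in> {i, k}")
      case True
      then have "g j l m = (if m = j then M $ l $ j else 0)" for m by (simp add: g_def)
      then show ?thesis using True by simp
    next
      case False
      then have "g j l m = M $ l $ m" for m by (simp add: g_def)
      then show ?thesis using False by (simp add: row_stochastic_sum[OF M])
    qed
    have "(\<Prod>l\<in>UNIV. \<Sum>m\<in>UNIV. g j l m) = (\<Prod>l\<in>{i, k}. M $ l $ j)"
      unfolding row using prod.inter_restrict[where A = UNIV and B = "{i, k}" and g = "\<lambda>l. M $ l $ j"] by simp
    then show ?thesis using \<open>i \<noteq> k\<close> by simp
  qed
  have "(\<Sum>f | f i = f k. \<Prod>l\<in>UNIV. M $ l $ f l)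
      = (\<Sum>f\<in>UNIV. \<Sum>j\<in>UNIV. \<Prod>l\<in>UNIV. g j l (f l))"
    unfolding * by (simp add: sum.If_cases)
  also have "\<dots> = (\<Sum>j\<in>UNIV. M $ i $ j * M $ k $ j)"
    by (subst sum.swap) (simp add: sum_prod_functions **)
  finally show ?thesis .
qed

lemma abs_det_row_stochastic_le_1:
  fixes M :: "real ^ 'n ^ 'n"
  assumes M: "row_stochastic M"
  shows "\<bar>det M\<bar> \<le> 1"
proof -
  have "(\<Sum>f | inj f. \<Prod>l\<in>UNIV. M $ l $ f l) \<le> (\<Sum>f\<in>UNIV. \<Prod>l\<in>UNIV. M $ l $ f l)"
    by (intro sum_mono2) (auto simp: row_stochastic_nonneg[OF M] intro!: prod_nonneg)
  then show ?thesis
    using abs_det_le_injective_sum[OF M] sum_functions_eq_1[OF M] by linarith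
qed

text \<open>An injective choice and a collision of rows \<open>i\<close> and \<open>k\<close> are
  disjoint events, so their probabilities add up to at most 1.\<close>

lemma row_product_le_one_minus_abs_det:
  fixes M :: "real ^ 'n ^ 'n"
  assumes M: "row_stochastic M" and "i \<noteq> k"
  shows "(\<Sum>j\<in>UNIV. M $ i $ j * M $ k $ j) \<le> 1 - \<bar>det M\<bar>"
proof -
  let ?w = "\<lambda>f. \<Prod>l\<in>UNIV. M $ l $ f l"
  have "sum ?w {f. inj f} + sum ?w {f. f i = f k} = sum ?w ({f. inj f} \<union> {f. f i = f k})"
    using \<open>i \<noteq> k\<close> by (intro sum.union_disjoint[symmetric]) (auto dest: injD)
  also have "\<dots> \<le> sum ?w UNIV"
    by (intro sum_mono2) (auto simp: row_stochastic_nonneg[OF M] intro!: prod_nonneg)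
  finally show ?thesis
    using abs_det_le_injective_sum[OF M] sum_functions_eq_1[OF M] sum_functions_collision[OF assms]
    by linarith
qed

lemma near_permutation_matrix:
  fixes M :: "real ^ 'n ^ 'n"
  assumes M: "row_stochastic M"
  shows "\<exists>P. permutation_matrix P \<and> max_entry_norm (M - P) \<le> (CARD('n))\<^sup>2 * (1 - \<bar>det M\<bar>)"
proof -
  define c where "c = real CARD('n)"
  define d where "d = 1 - \<bar>det M\<bar>"
  have c: "c \<ge> 1"
    using card_gt_0_iff[of "UNIV :: 'n set"] by (simp add: c_def)
  have d: "d \<ge> 0"
    using abs_det_row_stochastic_le_1[OF M] by (simp add: d_def)
  have prod_le: "M $ i $ j * M $ k $ j \<le> d" if "i \<noteq> k" for i j k
  proof -
    have "M $ i $ j * M $ k $ j \<le> (\<Sum>j\<in>UNIV. M $ i $ j * M $ k $ j)"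
      by (rule member_le_sum) (simp_all add: row_stochastic_nonneg[OF M])
    then show ?thesis
      using row_product_le_one_minus_abs_det[OF M that] by (simp add: d_def)
  qed
  have "\<exists>P. permutation_matrix P \<and> (\<forall>i j. \<bar>(M - P) $ i $ j\<bar> \<le> c\<^sup>2 * d)"
  \<comment> \<open>For a bound of 1 or more any permutation matrix will do, because all entries lie
    between 0 and 1. Otherwise \<open>d\<close> is below \<open>1 / c\<^sup>2\<close>, and the large
    entries locate the permutation.\<close>
  proof (cases "c\<^sup>2 * d \<ge> 1")
    case True
    have "\<bar>(M - mat 1) $ i $ j\<bar> \<le> 1" for i j
      using row_stochastic_nonneg[OF M, of i j] row_stochastic_le_1[OF M, of i j]
      by (auto simp: mat_def abs_le_iff)
    then show ?thesis
      using permutation_matrix_mat_1 order_trans[OF _ True] by metis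
  next
    case small: False
    \<comment> \<open>Pigeonhole: \<open>c\<close> entries sum to 1.\<close>
    have "\<exists>j. 1 / c \<le> M $ i $ j" for i
    proof (rule ccontr)
      assume "\<not> ?thesis"
      then have "(\<Sum>j\<in>UNIV. M $ i $ j) < (\<Sum>j\<in>(UNIV :: 'n set). 1 / c)"
        by (intro sum_strict_mono) (auto simp: not_le)
      then show False
        using c by (simp add: row_stochastic_sum[OF M] c_def)
    qed
    then obtain p where p: "\<And>i. 1 / c \<le> M $ i $ p i" by metis
    have "inj p"
    proof (rule injI, rule ccontr)
      fix i k assume eq: "p i = p k" and "i \<noteq> k"
      \<comment> \<open>Two large entries in one column would make the inner product of their rows
        too big for \<open>d\<close>.\<close>
      have "1 / c * (1 / c) \<le> M $ i $ p i * M $ k $ p i"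
        using p[of i] p[of k] eq c by (intro mult_mono) (auto simp: row_stochastic_nonneg[OF M])
      then have "1 / c * (1 / c) \<le> d"
        using prod_le[OF \<open>i \<noteq> k\<close>] by (rule order_trans)
      then have "1 \<le> c\<^sup>2 * d"
        using c by (simp add: field_simps power2_eq_square)
      then show False using small by simp
    qed
    then have bij: "bij p"
      using finite_UNIV_inj_surj[of p] by (simp add: bij_def)
    have off: "M $ k $ j \<le> c * d" if "j \<noteq> p k" for k j
    proof -
      \<comment> \<open>Column \<open>j\<close> already carries the large entry of another row
        \<open>i\<close>, which forces the entry of row \<open>k\<close> there to be small.\<close>
      obtain i where j: "j = p i" using bij by (meson bij_pointE)
      have "1 / c * M $ k $ j \<le> M $ i $ j * M $ k $ j"
        using p[of i] j by (intro mult_right_mono) (auto simp: row_stochastic_nonneg[OF M])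
      also have "\<dots> \<le> d"
        using prod_le[of i k j] that j by auto
      finally show ?thesis using c by (simp add: field_simps)
    qed
    have cd: "c * d \<le> c\<^sup>2 * d"
      using c d by (intro mult_right_mono) (auto simp: power2_eq_square)
    have diag: "1 - M $ k $ p k \<le> c\<^sup>2 * d" for k
    proof -
      have "1 = M $ k $ p k + (\<Sum>j\<in>UNIV - {p k}. M $ k $ j)"
        using sum.remove[of UNIV "p k" "\<lambda>j. M $ k $ j"] by (simp add: row_stochastic_sum[OF M])
      moreover have "(\<Sum>j\<in>UNIV - {p k}. M $ k $ j) \<le> (\<Sum>j\<in>UNIV - {p k}. c * d)"
        by (intro sum_mono) (simp add: off)
      moreover have "(\<Sum>j\<in>UNIV - {p k}. c * d) \<le> (\<Sum>j\<in>(UNIV :: 'n set). c * d)"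
        using c d by (intro sum_mono2) auto
      ultimately have "1 - M $ k $ p k \<le> (\<Sum>j\<in>(UNIV :: 'n set). c * d)"
        by linarith
      then show ?thesis
        by (simp add: c_def power2_eq_square mult.assoc)
    qed
    define P :: "real ^ 'n ^ 'n" where "P = (\<chi> i j. if j = p i then 1 else 0)"
    have "permutation_matrix P"
      unfolding permutation_matrix_def P_def using bij
      by (intro exI[of _ p]) (auto intro: bij_imp_permutes)
    moreover have "\<bar>(M - P) $ i $ j\<bar> \<le> c\<^sup>2 * d" for i j
      using off[of j i] cd diag[of i] row_stochastic_nonneg[OF M, of i j]
        row_stochastic_le_1[OF M, of i j]
      by (cases "j = p i") (auto simp: P_def)
    ultimately show ?thesis by blast
  qed
  then obtain P where "permutation_matrix P" "\<forall>i j. \<bar>(M - P) $ i $ j\<bar> \<le> c\<^sup>2 * d"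
    by blast
  then show ?thesis
    using max_entry_norm_le[of "M - P" "c\<^sup>2 * d"] by (auto simp: c_def d_def)
qed

section \<open>Full-rank chains\<close>

lemma tendsto_matrix_vector_mult:
  fixes M :: "'a \<Rightarrow> real ^ 'n ^ 'm"
  assumes "(M \<longlongrightarrow> L) F"
  shows "((\<lambda>x. M x *v v) \<longlongrightarrow> L *v v) F"
  unfolding matrix_vector_mult_def
  by (intro vec_tendstoI) (auto intro!: tendsto_intros assms)

lemma tendsto_det:
  fixes M :: "'a \<Rightarrow> real ^ 'n ^ 'n"
  assumes "(M \<longlongrightarrow> L) F"
  shows "((\<lambda>x. det (M x)) \<longlongrightarrow> det L) F"
  unfolding det_def by (intro tendsto_intros assms)

text \<open>The trivial null space serves to make the limit \<open>L\<close> of \<open>D\<close>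
  positive; then the terms are dominated by the telescoping differences of \<open>D\<close>, divided
  by \<open>L\<close>.\<close>

lemma summable_one_minus_abs_det:
  fixes A :: "nat \<Rightarrow> real ^ 'n ^ 'n"
  assumes A: "\<And>t. row_stochastic (A t)" and null: "chain_null A T = {0}"
  shows "summable (\<lambda>t. 1 - \<bar>det (A t)\<bar>)"
proof -
  let ?\<Phi> = "\<lambda>t. transition_matrix A t T"
  \<comment> \<open>Time is counted from \<open>T\<close>, before which the transition matrix is
    only a dummy.\<close>
  define D where "D t = \<bar>det (?\<Phi> (t + T))\<bar>" for t
  have D_Suc: "D (Suc t) = \<bar>det (A (t + T))\<bar> * D t" for t
    by (simp add: D_def det_mul abs_mult)
  have "D (Suc t) \<le> D t" for t
    using mult_right_mono[OF abs_det_row_stochastic_le_1[OF A], of "D t" "t + T"]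
    by (simp add: D_Suc) (simp add: D_def)
  then have dec: "decseq D" by (rule decseq_SucI)
  obtain L where L: "D \<longlonglongrightarrow> L" and L_le: "\<And>t. L \<le> D t"
    using decseq_convergent[OF dec, of 0] by (auto simp: D_def)
  have "bounded (range (\<lambda>t. ?\<Phi> (t + T)))"
    by (rule boundedI[where B = "CARD('n)"])
       (auto intro!: norm_row_stochastic_le row_stochastic_transition_matrix A)
  \<comment> \<open>The products themselves may fail to converge, as for a chain of permutations, so
    only a subsequence is used.\<close>
  then obtain M r where r: "strict_mono r" and M: "((\<lambda>t. ?\<Phi> (t + T)) \<circ> r) \<longlonglongrightarrow> M"
    by (blast dest: bounded_imp_convergent_subsequence)
  have "v = 0" if "M *v v = 0" for v
  proof -
    have lim: "(\<lambda>n. infnorm (?\<Phi> (r n + T) *v v)) \<longlonglongrightarrow> 0"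
      using tendsto_infnorm[OF tendsto_matrix_vector_mult[OF M, of v]] that
      by (simp add: infnorm_0 o_def)
    have mono: "decseq (\<lambda>t. infnorm (?\<Phi> (t + T) *v v))"
      by (intro decseq_SucI infnorm_transition_antimono A) auto
    \<comment> \<open>Monotonicity turns convergence to 0 along \<open>r\<close> into convergence
      along all times, which is what membership in the null space asks for.\<close>
    obtain l where l: "(\<lambda>t. infnorm (?\<Phi> (t + T) *v v)) \<longlonglongrightarrow> l"
      using decseq_convergent[OF mono, of 0] by (auto simp: infnorm_pos_le)
    have "l = 0"
      using LIMSEQ_unique[OF LIMSEQ_subseq_LIMSEQ[OF l r]] lim by (simp add: o_def)
    then have "(\<lambda>t. sqrt DIM(real ^ 'n) * infnorm (?\<Phi> (t + T) *v v)) \<longlonglongrightarrow> 0"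
      using tendsto_mult_left[OF l] by simp
    then have "(\<lambda>t. ?\<Phi> (t + T) *v v) \<longlonglongrightarrow> 0"
      by (rule Lim_null_comparison[rotated]) (intro always_eventually allI norm_le_infnorm)
    then have "v \<in> chain_null A T"
      unfolding chain_null_def by (auto intro: LIMSEQ_offset[where k = T])
    then show ?thesis using null by simp
  qed
  then have "invertible M"
    unfolding invertible_left_inverse matrix_left_invertible_ker by blast
  then have "det M \<noteq> 0"
    by (simp add: invertible_det_nz)
  have "(\<lambda>n. D (r n)) \<longlonglongrightarrow> \<bar>det M\<bar>"
    using tendsto_rabs[OF tendsto_det[OF M]] by (simp add: D_def o_def)
  then have "L = \<bar>det M\<bar>"
    using LIMSEQ_unique[OF LIMSEQ_subseq_LIMSEQ[OF L r]] by (simp add: o_def)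
  then have "L > 0" using \<open>det M \<noteq> 0\<close> by simp
  have "summable (\<lambda>t. (D t - D (Suc t)) / L)"
    using telescope_summable'[OF L] by (rule summable_divide)
  moreover have "norm (1 - \<bar>det (A (t + T))\<bar>) \<le> (D t - D (Suc t)) / L" for t
  proof -
    have le: "\<bar>det (A (t + T))\<bar> \<le> 1" by (rule abs_det_row_stochastic_le_1[OF A])
    \<comment> \<open>Replacing \<open>D t\<close> by its lower bound \<open>L\<close> gives one
      divisor for all \<open>t\<close>.\<close>
    have "(1 - \<bar>det (A (t + T))\<bar>) * L \<le> (1 - \<bar>det (A (t + T))\<bar>) * D t"
      using L_le[of t] le by (intro mult_left_mono) auto
    also have "\<dots> = D t - D (Suc t)" by (simp add: D_Suc algebra_simps)
    finally show ?thesis using le \<open>L > 0\<close> by (simp add: pos_le_divide_eq)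
  qed
  ultimately have "summable (\<lambda>t. 1 - \<bar>det (A (t + T))\<bar>)"
    by (rule summable_comparison_test')
  then show ?thesis
    by (simp add: summable_iff_shift[where f = "\<lambda>t. 1 - \<bar>det (A t)\<bar>"])
qed

text \<open>The dimensions are natural numbers, so converging to 0 means being eventually 0.\<close>

lemma chain_rank_full_iff:
  fixes A :: "nat \<Rightarrow> real ^ 'n ^ 'n"
  shows "chain_rank A = CARD('n) \<longleftrightarrow> (\<forall>\<^sub>F \<tau> in sequentially. chain_null A \<tau> = {0})"
proof -
  have null: "chain_null A \<tau> = {0} \<longleftrightarrow> dim (chain_null A \<tau>) = 0" for \<tau>
    using subspace_0[OF subspace_chain_null[of A \<tau>]] by (auto simp: dim_eq_0)
  \<comment> \<open>Even with truncated subtraction this holds, because \<open>CARD('n)\<close> is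
    positive.\<close>
  have "chain_rank A = CARD('n) \<longleftrightarrow> chain_nullity A = 0"
    unfolding chain_rank_def using zero_less_card_finite[where 'a = 'n] by arith
  also have "\<dots> \<longleftrightarrow> (\<lambda>\<tau>. dim (chain_null A \<tau>)) \<longlonglongrightarrow> 0"
  proof
    show "(\<lambda>\<tau>. dim (chain_null A \<tau>)) \<longlonglongrightarrow> 0" if "chain_nullity A = 0"
      using chain_nullity_tendsto[of A] that by simp
    show "chain_nullity A = 0" if "(\<lambda>\<tau>. dim (chain_null A \<tau>)) \<longlonglongrightarrow> 0"
      by (rule LIMSEQ_unique[OF chain_nullity_tendsto that])
  qed
  finally show ?thesis
    by (simp add: null tendsto_discrete)
qed

theorem theorem11:
  fixes A :: "nat \<Rightarrow> real ^ 'n ^ 'n"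
  assumes "\<And>t. row_stochastic (A t)"
  shows "chain_rank A = CARD('n) \<longleftrightarrow>
    (\<exists>P. (\<forall>t. permutation_matrix (P t)) \<and> l1_approximation A P)"
proof
  assume "chain_rank A = CARD('n)"
  then obtain T where "chain_null A T = {0}"
    unfolding chain_rank_full_iff using eventually_happens'[OF sequentially_bot] by blast
  then have sm: "summable (\<lambda>t. (CARD('n))\<^sup>2 * (1 - \<bar>det (A t)\<bar>))"
    by (intro summable_mult summable_one_minus_abs_det assms)
  have "\<forall>t. \<exists>Q. permutation_matrix Q \<and>
      max_entry_norm (A t - Q) \<le> (CARD('n))\<^sup>2 * (1 - \<bar>det (A t)\<bar>)"
    using near_permutation_matrix assms by auto
  from choice[OF this] obtain P where P: "\<And>t. permutation_matrix (P t)"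
    and le: "\<And>t. max_entry_norm (A t - P t) \<le> (CARD('n))\<^sup>2 * (1 - \<bar>det (A t)\<bar>)"
    by auto
  have "l1_approximation A P"
    unfolding l1_approximation_def
    by (rule summable_comparison_test'[OF sm]) (use le in \<open>simp add: max_entry_norm_nonneg\<close>)
  then show "\<exists>P. (\<forall>t. permutation_matrix (P t)) \<and> l1_approximation A P"
    using P by blast
next
  assume "\<exists>P. (\<forall>t. permutation_matrix (P t)) \<and> l1_approximation A P"
  then obtain P where P: "\<And>t. permutation_matrix (P t)" and l1: "l1_approximation A P"
    by blast
  show "chain_rank A = CARD('n)"
    unfolding chain_rank_full_iff by (rule chain_null_eventually_trivial[OF assms P l1])
qed

end
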